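(* For every non-negative integer $\Delta$ there is a connected (possibly infinite) graph $G$ with maximum degree $\Delta(G)=\Delta$ and $$\operatorname{rl_p}(G)\geq\left\lfloor\frac{\Delta^2}{4}\right\rfloor.$$
   Context: Graphs are simple and undirected and may be infinite; $d(\cdot,\cdot)$ denotes graph distance. The $k$-probe Robber Locating game on a graph $G$ (known to both players): a robber occupies a vertex of $G$, initially arbitrary and unknown to the cop. Cop and robber alternate turns, the cop first. At her turn the cop chooses a list $u_1,\ldots,u_k$ of vertices (all specified before any answer is received) and is then told the distances $d(v,u_1),\ldots,d(v,u_k)$, where $v$ is the robber's current location. If from this and all previous information she can deduce $v$, she wins. At his turn the robber may stay where he is or move to an adjacent vertex. $G$ is $k$-locatable if the cop has a deterministic strategy (each list of probes may depend on previous answers) which wins after finitely many turns against every possible starting vertex and sequence of moves of the robber. $\operatorname{rl_p}(G)$ is the minimum $k$ such that $G$ is $k$-locatable; thus $\operatorname{rl_p}(G)\geq N$ means that $G$ is not $k$-locatable for any $k<N$. *)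

theory Defs
  imports Main "HOL-Library.Extended_Nat"
begin

definition simple_graph :: "'a set \<Rightarrow> ('a \<times> 'a) set \<Rightarrow> bool" where
  "simple_graph V E \<longleftrightarrow> E \<subseteq> V \<times> V \<and> sym E \<and> irrefl E"

definition connected_graph :: "'a set \<Rightarrow> ('a \<times> 'a) set \<Rightarrow> bool" where
  "connected_graph V E \<longleftrightarrow> V \<noteq> {} \<and> (\<forall>u\<in>V. \<forall>v\<in>V. (u, v) \<in> E\<^sup>*)"

definition has_max_degree :: "'a set \<Rightarrow> ('a \<times> 'a) set \<Rightarrow> nat \<Rightarrow> bool" where
  "has_max_degree V E D \<longleftrightarrow>
     (\<forall>v\<in>V. finite (E `` {v}) \<and> card (E `` {v}) \<le> D) \<and>
     (\<exists>v\<in>V. card (E `` {v}) = D)"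

(* A walk of length n from u to v is a pair in the n-fold composition of E;
   the distance is infinite if there is no walk. *)
definition graph_dist :: "('a \<times> 'a) set \<Rightarrow> 'a \<Rightarrow> 'a \<Rightarrow> enat" where
  "graph_dist E u v = (INF n\<in>{n. (u, v) \<in> E ^^ n}. enat n)"

(* r t is the robber's location at the cop's turn number t, counted from 0. *)
definition robber_play :: "'a set \<Rightarrow> ('a \<times> 'a) set \<Rightarrow> (nat \<Rightarrow> 'a) \<Rightarrow> bool" where
  "robber_play V E r \<longleftrightarrow>
     (\<forall>t. r t \<in> V) \<and> (\<forall>t. r (Suc t) = r t \<or> (r t, r (Suc t)) \<in> E)"

(* A deterministic strategy maps the answers received so far, one list per
   turn, to the next list of probes. Earlier probes need not be recorded, since
   the strategy and the earlier answers determine them. *)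
type_synonym 'a strategy = "enat list list \<Rightarrow> 'a list"

definition k_probe_strategy :: "nat \<Rightarrow> 'a set \<Rightarrow> 'a strategy \<Rightarrow> bool" where
  "k_probe_strategy k V s \<longleftrightarrow> (\<forall>h. length (s h) = k \<and> set (s h) \<subseteq> V)"

primrec answers :: "('a \<times> 'a) set \<Rightarrow> 'a strategy \<Rightarrow> (nat \<Rightarrow> 'a) \<Rightarrow> nat \<Rightarrow> enat list list" where
  "answers E s r 0 = []"
| "answers E s r (Suc t) =
     answers E s r t @ [map (\<lambda>u. graph_dist E (r t) u) (s (answers E s r t))]"

(* The cop can deduce the current location at turn t iff all robber plays giving
   the same answers up to and including turn t agree on it. *)
definition located_at ::
    "'a set \<Rightarrow> ('a \<times> 'a) set \<Rightarrow> 'a strategy \<Rightarrow> (nat \<Rightarrow> 'a) \<Rightarrow> nat \<Rightarrow> bool" where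
  "located_at V E s r t \<longleftrightarrow>
     (\<forall>r'. robber_play V E r' \<and> answers E s r' (Suc t) = answers E s r (Suc t)
           \<longrightarrow> r' t = r t)"

(* The number of turns needed may depend on the robber's play. *)
definition k_locatable :: "nat \<Rightarrow> 'a set \<Rightarrow> ('a \<times> 'a) set \<Rightarrow> bool" where
  "k_locatable k V E \<longleftrightarrow>
     (\<exists>s. k_probe_strategy k V s \<and>
          (\<forall>r. robber_play V E r \<longrightarrow> (\<exists>t. located_at V E s r t)))"

(* The least such k, and infinity if there is none. *)
definition rl_p :: "'a set \<Rightarrow> ('a \<times> 'a) set \<Rightarrow> enat" where
  "rl_p V E = (INF k\<in>{k. k_locatable k V E}. enat k)"

lemma rl_p_ge_iff: "rl_p V E \<ge> enat N \<longleftrightarrow> (\<forall>k<N. \<not> k_locatable k V E)"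
  unfolding rl_p_def le_INF_iff by (auto simp: not_less)

end

theory Submission
  imports Defs
begin

text \<open>
  For \<open>\<Delta> \<ge> 3\<close> the graph is the infinite rooted tree in which every vertex has
  \<open>m = \<Delta> - 1\<close> children, so that every vertex except the root has degree \<open>\<Delta>\<close>. The robber
  walks away from the root, one step down at every turn. Suppose the cop even knows that he is
  at a child of the vertex \<open>c\<close>. A probe \<open>u\<close> distinguishes a child \<open>x\<close> of \<open>c\<close> from its
  siblings only if \<open>u\<close> lies in the subtree below \<open>x\<close>: all other children are at distance
  \<open>d(c,u) + 1\<close> from \<open>u\<close> (lemma \<open>graph_dist_child\<close>). Hence the children with
  no probe in their subtrees, which we call unprobed, all give the same answers.

  Let \<open>a = \<lceil>\<Delta>/2\<rceil> \<ge> 2\<close> and suppose that at least \<open>a\<close> children of \<open>c\<close> remain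
  possible after some turn. The robber steps down, and the cop chooses her next list of
  probes. For her to leave fewer than \<open>a\<close> unprobed children under each of the \<open>a\<close>
  candidates, she must hit at least \<open>m - (a - 1) = \<Delta> - a\<close> disjoint subtrees under each of
  them, which takes \<open>a (\<Delta> - a) = \<lfloor>\<Delta>\<^sup>2/4\<rfloor>\<close> probes (lemma
  \<open>exists_child_with_unprobed\<close>). With fewer probes, at least \<open>a\<close> unprobed children remain
  under some candidate, and the situation repeats itself for ever. The answers that the robber
  gives do not depend on which unprobed child he is at, so the choice of the next
  candidate may be made with the cop's next list of probes in view; this is
  what makes the recursive construction of his play in \<open>not_k_locatable_tree\<close> possible.

  For \<open>\<Delta> \<le> 2\<close> the bound is at most \<open>1\<close>, and is \<open>1\<close> only for \<open>\<Delta> = 2\<close>; the complete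
  graph on \<open>\<Delta> + 1\<close> vertices serves, since without probes nothing is ever learnt.
\<close>

section \<open>The infinite rooted tree\<close>

text \<open>
  The vertices are numbered as in an \<open>m\<close>-ary heap. A number exceeds that of its parent,
  which gives well-foundedness for free, and makes it easy to find a subtree without probes.
\<close>

definition child_rel :: "nat \<Rightarrow> (nat \<times> nat) set" where
  "child_rel m = {(x, c). m * c < x \<and> x \<le> m * c + m}"

definition tree_edges :: "nat \<Rightarrow> (nat \<times> nat) set" where
  "tree_edges m = child_rel m \<union> (child_rel m)\<inverse>"

definition unprobed :: "nat \<Rightarrow> nat \<Rightarrow> nat list \<Rightarrow> nat set" where
  "unprobed m c q = {x. (x, c) \<in> child_rel m \<and> (\<forall>u\<in>set q. (u, x) \<notin> (child_rel m)\<^sup>*)}"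

lemma child_rel_less: "(x, c) \<in> child_rel m \<Longrightarrow> c < x"
proof -
  assume "(x, c) \<in> child_rel m"
  then have h: "m * c < x" "x \<le> m * c + m" by (auto simp: child_rel_def)
  then have "m \<ge> 1" by (cases m) auto
  then have "c \<le> m * c" by simp
  with h show "c < x" by linarith
qed

lemma descendant_ge: "(u, x) \<in> (child_rel m)\<^sup>* \<Longrightarrow> x \<le> u"
  by (induction rule: rtrancl_induct) (auto dest: child_rel_less)

lemma parent_unique:
  assumes "(x, c) \<in> child_rel m" "(x, d) \<in> child_rel m"
  shows "c = d"
proof -
  have "\<not> i < j" if "(x, i) \<in> child_rel m" "(x, j) \<in> child_rel m" for i j
  proof
    assume "i < j"
    then have "m * Suc i \<le> m * j" by (intro mult_le_mono2) simp
    with that show False by (simp add: child_rel_def)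
  qed
  with assms show ?thesis by (meson nat_neq_iff)
qed

lemma parent_exists:
  assumes "m \<ge> 1" "x > 0"
  obtains c where "(x, c) \<in> child_rel m"
proof
  have "m * ((x - 1) div m) + (x - 1) mod m = x - 1" by simp
  moreover have "(x - 1) mod m < m" using assms by simp
  ultimately show "(x, (x - 1) div m) \<in> child_rel m"
    using assms(2) unfolding child_rel_def mem_Collect_eq case_prod_conv by linarith
qed

lemma card_children: "card {x. (x, c) \<in> child_rel m} = m"
  and finite_children: "finite {x. (x, c) \<in> child_rel m}"
proof -
  have "{x. (x, c) \<in> child_rel m} = {m * c<..m * c + m}" by (auto simp: child_rel_def)
  then show "card {x. (x, c) \<in> child_rel m} = m" "finite {x. (x, c) \<in> child_rel m}" by auto
qed

lemma simple_graph_tree: "simple_graph UNIV (tree_edges m)"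
  by (auto simp: simple_graph_def tree_edges_def sym_def irrefl_def dest: child_rel_less)

lemma connected_graph_tree:
  assumes "m \<ge> 1"
  shows "connected_graph UNIV (tree_edges m)"
proof -
  have root: "(v, 0) \<in> (tree_edges m)\<^sup>*" for v
  proof (induction v rule: less_induct)
    case (less v)
    show ?case
    proof (cases "v = 0")
      case False
      then obtain c where c: "(v, c) \<in> child_rel m" using parent_exists[OF assms] by blast
      then have "(c, 0) \<in> (tree_edges m)\<^sup>*" by (intro less child_rel_less)
      moreover have "(v, c) \<in> tree_edges m" using c by (simp add: tree_edges_def)
      ultimately show ?thesis by simp
    qed simp
  qed
  have "sym ((tree_edges m)\<^sup>*)"
    using simple_graph_tree by (intro sym_rtrancl) (simp add: simple_graph_def)
  with root show ?thesis
    unfolding connected_graph_def by (auto dest: symD intro: rtrancl_trans)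
qed

lemma has_max_degree_tree:
  assumes "m \<ge> 1"
  shows "has_max_degree UNIV (tree_edges m) (Suc m)"
proof -
  define par where "par v = {c. (v, c) \<in> child_rel m}" for v
  have nbrs: "tree_edges m `` {v} = {x. (x, v) \<in> child_rel m} \<union> par v" for v
    by (auto simp: tree_edges_def par_def)
  have disj: "{x. (x, v) \<in> child_rel m} \<inter> par v = {}" for v
    by (auto simp: par_def dest!: child_rel_less)
  have par: "par v = {c}" if "(v, c) \<in> child_rel m" for v c
    using that parent_unique by (auto simp: par_def)
  have small: "finite (par v) \<and> card (par v) \<le> 1" for v
  proof (cases "par v = {}")
    case False
    then obtain c where "(v, c) \<in> child_rel m" by (auto simp: par_def)
    then show ?thesis by (simp add: par)
  qed simp
  have deg: "card (tree_edges m `` {v}) = m + card (par v)" for v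
    unfolding nbrs using small disj finite_children card_children
    by (subst card_Un_disjoint) auto
  have "(1, 0) \<in> child_rel m" using assms by (simp add: child_rel_def)
  then have "card (tree_edges m `` {1}) = Suc m" by (simp add: deg par)
  moreover have "finite (tree_edges m `` {v})" for v
    unfolding nbrs using small finite_children by simp
  moreover have "card (tree_edges m `` {v}) \<le> Suc m" for v
    using small[of v] by (simp add: deg)
  ultimately show ?thesis unfolding has_max_degree_def by blast
qed

section \<open>Subtrees and distances\<close>

text \<open>The edge from \<open>x\<close> to its parent is the only one that leaves the subtree below \<open>x\<close>.\<close>

lemma walk_leaving_subtree:
  assumes "(x, c) \<in> child_rel m" "(y, x) \<in> (child_rel m)\<^sup>*" "(u, x) \<notin> (child_rel m)\<^sup>*"
    and "(y, u) \<in> tree_edges m ^^ n"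
  shows "\<exists>k<n. (c, u) \<in> tree_edges m ^^ k"
  using assms(2,4)
proof (induction n arbitrary: y)
  case 0
  then show ?case using assms(3) by simp
next
  case (Suc n)
  then obtain z where z: "(y, z) \<in> tree_edges m" "(z, u) \<in> tree_edges m ^^ n"
    by (meson relpow_Suc_D2)
  show ?case
  proof (cases "(z, x) \<in> (child_rel m)\<^sup>*")
    case True
    then show ?thesis using Suc.IH[OF True z(2)] less_SucI by blast
  next
    case False
    have yz: "(y, z) \<in> child_rel m"
    proof (rule ccontr)
      assume "(y, z) \<notin> child_rel m"
      with z(1) have "(z, y) \<in> child_rel m" by (simp add: tree_edges_def)
      with Suc.prems(1) False show False by (meson converse_rtrancl_into_rtrancl)
    qed
    have "y = x"
    proof (rule ccontr)
      assume "y \<noteq> x"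
      with Suc.prems(1) obtain w where "(y, w) \<in> child_rel m" "(w, x) \<in> (child_rel m)\<^sup>*"
        by (meson converse_rtranclE)
      with yz False show False using parent_unique by blast
    qed
    with yz assms(1) have "z = c" using parent_unique by blast
    with z(2) show ?thesis by blast
  qed
qed

lemma graph_dist_child:
  assumes "(x, c) \<in> child_rel m" "(u, x) \<notin> (child_rel m)\<^sup>*"
  shows "graph_dist (tree_edges m) x u = eSuc (graph_dist (tree_edges m) c u)"
proof (rule antisym)
  have xc: "(x, c) \<in> tree_edges m" using assms(1) by (simp add: tree_edges_def)
  show "graph_dist (tree_edges m) x u \<le> eSuc (graph_dist (tree_edges m) c u)"
  proof (cases "{n. (c, u) \<in> tree_edges m ^^ n} = {}")
    case True
    then show ?thesis by (simp add: graph_dist_def top_enat_def)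
  next
    case False
    \<comment> \<open>The infimum is attained, so a shortest walk from \<open>c\<close> can be prolonged to \<open>x\<close>.\<close>
    then have "graph_dist (tree_edges m) c u \<in> enat ` {n. (c, u) \<in> tree_edges m ^^ n}"
      unfolding graph_dist_def Inf_enat_def by (auto intro: LeastI)
    then obtain n where n: "graph_dist (tree_edges m) c u = enat n" "(c, u) \<in> tree_edges m ^^ n"
      by blast
    then have "(x, u) \<in> tree_edges m ^^ Suc n" using xc by (meson relpow_Suc_I2)
    then have "graph_dist (tree_edges m) x u \<le> enat (Suc n)"
      unfolding graph_dist_def by (intro INF_lower) simp
    then show ?thesis by (simp add: n(1) eSuc_enat)
  qed
  show "eSuc (graph_dist (tree_edges m) c u) \<le> graph_dist (tree_edges m) x u"
    unfolding graph_dist_def[of _ x]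
  proof (rule INF_greatest)
    fix n assume "n \<in> {n. (x, u) \<in> tree_edges m ^^ n}"
    then obtain k where "k < n" "(c, u) \<in> tree_edges m ^^ k"
      using walk_leaving_subtree[OF assms(1) _ assms(2)] by blast
    then have "graph_dist (tree_edges m) c u \<le> enat k"
      unfolding graph_dist_def by (intro INF_lower) simp
    then have "eSuc (graph_dist (tree_edges m) c u) \<le> enat (Suc k)"
      by (simp flip: eSuc_enat)
    also have "\<dots> \<le> enat n" using \<open>k < n\<close> by simp
    finally show "eSuc (graph_dist (tree_edges m) c u) \<le> enat n" .
  qed
qed

lemma siblings_disjoint_subtrees:
  assumes "(x, c) \<in> child_rel m" "(y, c) \<in> child_rel m"
    and "(u, x) \<in> (child_rel m)\<^sup>*" "(u, y) \<in> (child_rel m)\<^sup>*"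
  shows "x = y"
proof -
  have strict: "v = w"
    if "(v, c) \<in> child_rel m" "(w, c) \<in> child_rel m" "(v, w) \<in> (child_rel m)\<^sup>*" for v w
  proof (rule ccontr)
    assume "v \<noteq> w"
    with that(3) obtain z where z: "(v, z) \<in> child_rel m" "(z, w) \<in> (child_rel m)\<^sup>*"
      by (meson converse_rtranclE)
    then have "z = c" using that(1) parent_unique by blast
    then have "w \<le> c" using z(2) descendant_ge by blast
    with that(2) child_rel_less show False by fastforce
  qed
  \<comment> \<open>The ancestors of \<open>u\<close> form a chain.\<close>
  have "single_valued (child_rel m)" by (auto simp: single_valued_def intro: parent_unique)
  then have "(x, y) \<in> (child_rel m)\<^sup>* \<or> (y, x) \<in> (child_rel m)\<^sup>*"
    using assms(3,4) by (rule single_valued_confluent)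
  with assms(1,2) strict show ?thesis by metis
qed

section \<open>Counting unprobed children\<close>

lemma finite_unprobed: "finite (unprobed m c q)"
  by (rule finite_subset[OF _ finite_children]) (auto simp: unprobed_def)

text \<open>
  A child of \<open>c\<close> that is not unprobed uses up a probe in its own subtree. The subtrees of
  the grandchildren of \<open>p\<close> are disjoint, so these probes are distinct.
\<close>

lemma exists_child_with_unprobed:
  assumes A: "\<And>c. c \<in> A \<Longrightarrow> (c, p) \<in> child_rel m" "a \<le> card A"
    and q: "length q < a * (Suc m - a)"
  shows "\<exists>c\<in>A. a \<le> card (unprobed m c q)"
proof (rule ccontr)
  assume neg: "\<not> ?thesis"
  define B where "B c = {x. (x, c) \<in> child_rel m} - unprobed m c q" for c
  have fin: "finite A" using A(1) by (intro finite_subset[OF _ finite_children[of p m]]) auto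
  have finB: "finite (B c)" for c unfolding B_def using finite_children by simp
  have cardB: "Suc m - a \<le> card (B c)" if "c \<in> A" for c
  proof -
    have "card (B c) = m - card (unprobed m c q)"
      unfolding B_def using finite_unprobed card_children
      by (subst card_Diff_subset) (auto simp: unprobed_def)
    with neg that show ?thesis by force
  qed
  have "a * (Suc m - a) \<le> card A * (Suc m - a)" using A(2) by simp
  also have "\<dots> \<le> (\<Sum>c\<in>A. card (B c))"
    using sum_mono[of A "\<lambda>_. Suc m - a" "\<lambda>c. card (B c)"] cardB by simp
  also have "\<dots> = card (\<Union>c\<in>A. B c)"
    using fin finB parent_unique by (subst card_UN_disjoint) (auto simp: B_def)
  also have "\<dots> \<le> card (set q)"
  proof -
    have "\<forall>x\<in>(\<Union>c\<in>A. B c). \<exists>u\<in>set q. (u, x) \<in> (child_rel m)\<^sup>*"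
      by (auto simp: B_def unprobed_def)
    then obtain f where f: "\<forall>x\<in>(\<Union>c\<in>A. B c). f x \<in> set q \<and> (f x, x) \<in> (child_rel m)\<^sup>*"
      by metis
    have "inj_on f (\<Union>c\<in>A. B c)"
    proof (rule inj_onI)
      fix x y assume xy: "x \<in> (\<Union>c\<in>A. B c)" "y \<in> (\<Union>c\<in>A. B c)" "f x = f y"
      then obtain c d where c: "c \<in> A" "(x, c) \<in> child_rel m" and d: "d \<in> A" "(y, d) \<in> child_rel m"
        by (auto simp: B_def)
      have under: "(f x, x) \<in> (child_rel m)\<^sup>*" "(f x, y) \<in> (child_rel m)\<^sup>*"
        using f xy by force+
      then have "(f x, c) \<in> (child_rel m)\<^sup>*" "(f x, d) \<in> (child_rel m)\<^sup>*"
        using c(2) d(2) by (auto intro: rtrancl_into_rtrancl)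
      then have "c = d" using siblings_disjoint_subtrees A(1) c(1) d(1) by blast
      with c(2) d(2) under show "x = y" using siblings_disjoint_subtrees by blast
    qed
    then show ?thesis using f by (intro card_inj_on_le) auto
  qed
  also have "\<dots> \<le> length q" by (rule card_length)
  finally show False using q by simp
qed

section \<open>The evading robber\<close>

lemma answers_cong:
  "(\<And>i. i < t \<Longrightarrow> r i = r' i) \<Longrightarrow> answers E s r t = answers E s r' t"
  by (induction t) auto

text \<open>
  In the recursive construction of the robber's play, a state \<open>(h, b)\<close> consists of the
  answers before the current turn and the parent \<open>b\<close> of his current location. The
  invariant is that \<open>b\<close> has at least \<open>a\<close> children without probes below them in the list
  \<open>s h\<close>. In the next state the parent is one of these, namely the robber's current location.
\<close>

theorem not_k_locatable_tree:
  assumes a: "2 \<le> a" "a \<le> m" and k: "k < a * (Suc m - a)"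
  shows "\<not> k_locatable k UNIV (tree_edges m)"
proof
  assume "k_locatable k UNIV (tree_edges m)"
  then obtain s where s: "\<And>h. length (s h) = k"
    and win: "\<And>r. robber_play UNIV (tree_edges m) r \<Longrightarrow>
      \<exists>t. located_at UNIV (tree_edges m) s r t"
    unfolding k_locatable_def k_probe_strategy_def by blast
  let ?d = "graph_dist (tree_edges m)"
  have dist: "?d x u = eSuc (?d b u)" if "x \<in> unprobed m b q" "u \<in> set q" for x b u q
    using that by (intro graph_dist_child) (auto simp: unprobed_def)
  define inv where "inv t hb \<longleftrightarrow> (t = 0 \<longrightarrow> fst hb = []) \<and>
    a \<le> card (unprobed m (snd hb) (s (fst hb)))" for t :: nat and hb :: "enat list list \<times> nat"
  define succ where "succ hb hb' \<longleftrightarrow> snd hb' \<in> unprobed m (snd hb) (s (fst hb)) \<and>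
    fst hb' = fst hb @ [map (?d (snd hb')) (s (fst hb))]" for hb hb' :: "enat list list \<times> nat"
  have "\<exists>f. \<forall>t. inv t (f t) \<and> succ (f t) (f (Suc t))"
  proof (rule dependent_nat_choice)
    \<comment> \<open>All vertices below \<open>b\<close> have larger numbers than any initial probe.\<close>
    define b where "b = Max (insert 0 (set (s [])))"
    have "unprobed m b (s []) = {x. (x, b) \<in> child_rel m}"
    proof -
      have "(u, x) \<notin> (child_rel m)\<^sup>*" if "u \<in> set (s [])" "(x, b) \<in> child_rel m" for u x
      proof
        assume "(u, x) \<in> (child_rel m)\<^sup>*"
        then have "b < u" using that(2) descendant_ge child_rel_less by fastforce
        moreover have "u \<le> b" unfolding b_def using that(1) by (intro Max_ge) auto
        ultimately show False by simp
      qed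
      then show ?thesis by (auto simp: unprobed_def)
    qed
    then have "inv 0 ([], b)" using a(2) card_children by (simp add: inv_def)
    then show "\<exists>hb. inv 0 hb" ..
  next
    fix hb t assume inv: "inv t hb"
    obtain h b where hb: "hb = (h, b)" by fastforce
    let ?U = "unprobed m b (s h)"
    \<comment> \<open>The next history is the same for all unprobed children of \<open>b\<close>; hence the cop's next
      list of probes is determined before the robber commits himself to one of them.\<close>
    define h' where "h' = h @ [map (\<lambda>u. eSuc (?d b u)) (s h)]"
    have h': "h' = h @ [map (?d c) (s h)]" if "c \<in> ?U" for c
      using dist[OF that] by (simp add: h'_def)
    have "\<exists>c\<in>?U. a \<le> card (unprobed m c (s h'))"
      using inv k s
      by (intro exists_child_with_unprobed[of _ b]) (auto simp: unprobed_def inv_def hb)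
    then obtain c where "c \<in> ?U" "a \<le> card (unprobed m c (s h'))" by blast
    with h' have "inv (Suc t) (h', c) \<and> succ hb (h', c)" by (simp add: inv_def succ_def hb)
    then show "\<exists>hb'. inv (Suc t) hb' \<and> succ hb hb'" ..
  qed
  then obtain f where f: "\<And>t. inv t (f t)" "\<And>t. succ (f t) (f (Suc t))" by blast
  define r where "r t = snd (f (Suc t))" for t
  have hist: "answers (tree_edges m) s r t = fst (f t)" for t
  proof (induction t)
    case 0
    then show ?case using f(1)[of 0] by (simp add: inv_def)
  next
    case (Suc t)
    then show ?case using f(2)[of t] by (simp add: succ_def r_def)
  qed
  have edge: "(snd (f t), x) \<in> tree_edges m" if "x \<in> unprobed m (snd (f t)) q" for t x q
    using that by (simp add: unprobed_def tree_edges_def)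
  have step: "r t \<in> unprobed m (snd (f t)) (s (fst (f t)))" for t
    using f(2)[of t] by (simp add: succ_def r_def)
  have "robber_play UNIV (tree_edges m) r"
    unfolding robber_play_def using edge[OF step] by (auto simp: r_def)
  then obtain t where t: "located_at UNIV (tree_edges m) s r t" using win by blast
  let ?U = "unprobed m (snd (f t)) (s (fst (f t)))"
  have "\<exists>y\<in>?U. y \<noteq> r t"
  proof (rule ccontr)
    assume "\<not> ?thesis"
    then have "?U \<subseteq> {r t}" by blast
    then have "card ?U \<le> 1" using card_mono[of "{r t}" ?U] by simp
    with f(1)[of t] a(1) show False by (simp add: inv_def)
  qed
  then obtain y where y: "y \<in> ?U" "y \<noteq> r t" by blast
  \<comment> \<open>The confounding play takes the other branch at turn \<open>t\<close> and then stands still.\<close>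
  define r' where "r' i = (if i < t then r i else y)" for i
  have "r' (Suc i) = r' i \<or> (r' i, r' (Suc i)) \<in> tree_edges m" for i
  proof -
    consider "Suc i < t" | "Suc i = t" | "t \<le> i" by linarith
    then show ?thesis
    proof cases
      case 1
      then show ?thesis using edge[OF step[of "Suc i"]] by (simp add: r'_def r_def)
    next
      case 2
      then show ?thesis using edge[OF y(1)] by (auto simp: r'_def r_def)
    next
      case 3
      then show ?thesis by (simp add: r'_def)
    qed
  qed
  then have play: "robber_play UNIV (tree_edges m) r'" by (simp add: robber_play_def)
  have "answers (tree_edges m) s r' t = answers (tree_edges m) s r t"
    by (rule answers_cong) (simp add: r'_def)
  moreover have "?d (r' t) u = ?d (r t) u" if "u \<in> set (s (fst (f t)))" for u
    using dist[OF y(1) that] dist[OF step that] by (simp add: r'_def)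
  ultimately have "answers (tree_edges m) s r' (Suc t) = answers (tree_edges m) s r (Suc t)"
    by (simp add: hist)
  with t play have "r' t = r t" unfolding located_at_def by blast
  with y(2) show False by (simp add: r'_def)
qed

section \<open>Small degrees\<close>

lemma complete_graph_properties:
  fixes D :: nat
  defines "E \<equiv> {(i, j). i \<le> D \<and> j \<le> D \<and> i \<noteq> j}"
  shows "simple_graph {..D} E" "connected_graph {..D} E" "has_max_degree {..D} E D"
proof -
  show "simple_graph {..D} E" by (auto simp: simple_graph_def E_def sym_def irrefl_def)
  have "(u, v) \<in> E\<^sup>*" if "u \<le> D" "v \<le> D" for u v
    using that by (cases "u = v") (auto simp: E_def)
  then show "connected_graph {..D} E" by (simp add: connected_graph_def)
  have "E `` {v} = {..D} - {v}" if "v \<le> D" for v using that by (auto simp: E_def)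
  then show "has_max_degree {..D} E D" by (auto simp: has_max_degree_def)
qed

lemma not_0_locatable:
  assumes "u \<in> V" "v \<in> V" "u \<noteq> v"
  shows "\<not> k_locatable 0 V E"
proof
  assume "k_locatable 0 V E"
  then obtain s where s: "\<And>h. s h = []"
    and win: "\<And>r. robber_play V E r \<Longrightarrow> \<exists>t. located_at V E s r t"
    unfolding k_locatable_def k_probe_strategy_def by auto
  have play: "robber_play V E (\<lambda>_. w)" if "w \<in> V" for w
    using that by (simp add: robber_play_def)
  have "answers E s r t = answers E s r' t" for r r' t by (induction t) (simp_all add: s)
  with win[OF play[OF assms(1)]] play[OF assms(2)] assms(3) show False
    unfolding located_at_def by metis
qed

section \<open>The lower bound\<close>

theorem theorem10:
  fixes \<Delta> :: nat
  shows "\<exists>(V :: nat set) (E :: (nat \<times> nat) set).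
           simple_graph V E \<and> connected_graph V E \<and> has_max_degree V E \<Delta> \<and>
           rl_p V E \<ge> enat (\<Delta>\<^sup>2 div 4)"
proof (cases "\<Delta> \<le> 2")
  case True
  let ?E = "{(i, j). i \<le> \<Delta> \<and> j \<le> \<Delta> \<and> i \<noteq> j}"
  have "\<not> k_locatable k {..\<Delta>} ?E" if "k < \<Delta>\<^sup>2 div 4" for k
  proof -
    have "\<Delta> = 0 \<or> \<Delta> = 1 \<or> \<Delta> = 2" using True by linarith
    with that have "\<Delta> = 2" "k = 0" by (auto simp: power2_eq_square)
    then show ?thesis using not_0_locatable[of 0 "{..\<Delta>}" 1] by simp
  qed
  then have "rl_p {..\<Delta>} ?E \<ge> enat (\<Delta>\<^sup>2 div 4)" by (simp add: rl_p_ge_iff)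
  with complete_graph_properties[of \<Delta>] show ?thesis by blast
next
  case False
  define m where "m = \<Delta> - 1"
  define a where "a = (\<Delta> + 1) div 2"
  have m: "m \<ge> 1" "\<Delta> = Suc m" and a: "2 \<le> a" "a \<le> m"
    using False by (auto simp: m_def a_def)
  have "\<Delta>\<^sup>2 div 4 = a * (\<Delta> - a)"
  proof (cases "even \<Delta>")
    case True
    then obtain n where "\<Delta> = 2 * n" by (elim evenE)
    then show ?thesis by (simp add: a_def power2_eq_square)
  next
    case False
    then obtain n where n: "\<Delta> = 2 * n + 1" by (elim oddE)
    then have "\<Delta>\<^sup>2 = 4 * (n * n + n) + 1" by (simp add: power2_eq_square algebra_simps)
    with n show ?thesis by (simp add: a_def)
  qed
  then have "rl_p UNIV (tree_edges m) \<ge> enat (\<Delta>\<^sup>2 div 4)"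
    using not_k_locatable_tree[OF a] m(2) by (simp add: rl_p_ge_iff)
  with simple_graph_tree connected_graph_tree has_max_degree_tree m show ?thesis by metis
qed

end
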